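(* Let $n\geq 1$. Then: (i) $\mathrm{Cong}(\mathcal{P}_n^\Phi)$ contains no infinite (strictly) ascending chains; (ii) $\mathrm{Cong}(\mathcal{P}_n^\Phi)$ contains infinite (strictly) descending chains; (iii) $\mathrm{Cong}(\mathcal{P}_n^\Phi)$ contains infinite antichains.
   Context: Let $\mathbb{N}=\{0,1,2,\dots\}$ and, for $n\ge 1$, let $[n]=\{1,\dots,n\}$, with disjoint copies $[n]'=\{1',\dots,n'\}$ and $[n]''=\{1'',\dots,n''\}$. The partition monoid $\mathcal{P}_n$ consists of all set partitions of $[n]\cup[n]'$. For $\alpha,\beta\in\mathcal{P}_n$ the product graph $\Gamma(\alpha,\beta)$ has vertex set $[n]\cup[n]''\cup[n]'$; two vertices of $[n]\cup[n]''$ are joined when they lie in a common block of $\alpha$ after renaming each $x'$ of $\alpha$ to $x''$, and two vertices of $[n]''\cup[n]'$ are joined when they lie in a common block of $\beta$ after renaming each $x$ of $\beta$ to $x''$. The product $\alpha\beta\in\mathcal{P}_n$ is the partition in which $x,y\in[n]\cup[n]'$ are in the same block iff they lie in the same connected component of $\Gamma(\alpha,\beta)$. $\Phi(\alpha,\beta)$ is the number of connected components of $\Gamma(\alpha,\beta)$ wholly contained in $[n]''$. The twisted partition monoid is $\mathcal{P}_n^\Phi=\mathbb{N}\times\mathcal{P}_n$ with product $(i,\alpha)(j,\beta)=(i+j+\Phi(\alpha,\beta),\alpha\beta)$. For a monoid $M$, $\mathrm{Cong}(M)$ is the lattice of all congruences on $M$ ordered by inclusion. *)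

theory Defs
  imports "HOL-Library.Disjoint_Sets" "HOL-Algebra.Group"
begin

text \<open>
  \<open>Up x\<close>, \<open>Mid x\<close>, \<open>Low x\<close> stand for \<open>x\<close>, \<open>x''\<close>, \<open>x'\<close>; the middle
  vertices occur only in product graphs.
\<close>

datatype vertex = Up nat | Mid nat | Low nat

definition uppers :: "nat \<Rightarrow> vertex set" where
  "uppers n = Up ` {1..n}"

definition middles :: "nat \<Rightarrow> vertex set" where
  "middles n = Mid ` {1..n}"

definition lowers :: "nat \<Rightarrow> vertex set" where
  "lowers n = Low ` {1..n}"

definition partitions :: "nat \<Rightarrow> vertex set set set" where
  "partitions n = {\<alpha>. partition_on (uppers n \<union> lowers n) \<alpha>}"

fun lower_to_middle :: "vertex \<Rightarrow> vertex" where
  "lower_to_middle (Low x) = Mid x"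
| "lower_to_middle v = v"

fun upper_to_middle :: "vertex \<Rightarrow> vertex" where
  "upper_to_middle (Up x) = Mid x"
| "upper_to_middle v = v"

text \<open>
  The edge relation of \<open>\<Gamma>(\<alpha>,\<beta>)\<close>. It is symmetric, and it contains loops, which do not
  affect connectivity; so connectivity is its reflexive transitive closure.
\<close>

definition product_edges :: "vertex set set \<Rightarrow> vertex set set \<Rightarrow> vertex rel" where
  "product_edges \<alpha> \<beta> =
     {(u, v). (\<exists>A\<in>\<alpha>. u \<in> lower_to_middle ` A \<and> v \<in> lower_to_middle ` A) \<or>
              (\<exists>B\<in>\<beta>. u \<in> upper_to_middle ` B \<and> v \<in> upper_to_middle ` B)}"

definition connected_on :: "vertex set \<Rightarrow> vertex set set \<Rightarrow> vertex set set \<Rightarrow> vertex rel" where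
  "connected_on V \<alpha> \<beta> = {(u, v). u \<in> V \<and> v \<in> V \<and> (u, v) \<in> (product_edges \<alpha> \<beta>)\<^sup>*}"

definition product_components :: "nat \<Rightarrow> vertex set set \<Rightarrow> vertex set set \<Rightarrow> vertex set set" where
  "product_components n \<alpha> \<beta> =
     (let V = uppers n \<union> middles n \<union> lowers n in V // connected_on V \<alpha> \<beta>)"

definition partition_mult :: "nat \<Rightarrow> vertex set set \<Rightarrow> vertex set set \<Rightarrow> vertex set set" where
  "partition_mult n \<alpha> \<beta> =
     (let X = uppers n \<union> lowers n in X // connected_on X \<alpha> \<beta>)"

definition partition_one :: "nat \<Rightarrow> vertex set set" where
  "partition_one n = {{Up x, Low x} | x. x \<in> {1..n}}"

text \<open>\<open>floating n \<alpha> \<beta>\<close> is \<open>\<Phi>(\<alpha>,\<beta>)\<close>.\<close>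

definition floating :: "nat \<Rightarrow> vertex set set \<Rightarrow> vertex set set \<Rightarrow> nat" where
  "floating n \<alpha> \<beta> = card {C \<in> product_components n \<alpha> \<beta>. C \<subseteq> middles n}"

definition twisted_partition_monoid :: "nat \<Rightarrow> (nat \<times> vertex set set) monoid" where
  "twisted_partition_monoid n =
     \<lparr>carrier = UNIV \<times> partitions n,
      mult = (\<lambda>(i, \<alpha>) (j, \<beta>). (i + j + floating n \<alpha> \<beta>, partition_mult n \<alpha> \<beta>)),
      one = (0, partition_one n)\<rparr>"

text \<open>The lattice order on \<open>Cong M\<close> is inclusion of relations.\<close>

definition Cong :: "('a, 'b) monoid_scheme \<Rightarrow> 'a rel set" where
  "Cong M = {r. equiv (carrier M) r \<and>
     (\<forall>(a, b) \<in> r. \<forall>(c, d) \<in> r. (a \<otimes>\<^bsub>M\<^esub> c, b \<otimes>\<^bsub>M\<^esub> d) \<in> r)}"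

end

theory Submission
  imports Defs "HOL-Library.Infinite_Set" "HOL-Computational_Algebra.Primes"
begin

text \<open>
  Multiplication by \<open>(1, id)\<close> shifts the first coordinate, so a congruence is a
  shift-invariant equivalence on \<open>\<nat> \<times> \<P>\<^sub>n\<close>, and \<open>\<P>\<^sub>n\<close> is finite. In a strictly ascending
  chain pick a new pair \<open>((a\<^sub>k, \<alpha>), (b\<^sub>k, \<beta>))\<close> at each step; by pigeonhole \<open>\<alpha>\<close> and \<open>\<beta>\<close> may be
  taken constant. If all differences \<open>a\<^sub>k - b\<^sub>k\<close> agree, a later pair is a shift of an earlier
  one. Otherwise two of the pairs force the rows of \<open>\<alpha>\<close> and of \<open>\<beta>\<close> to be eventually periodic,
  so only finitely many pairs are possible up to equivalence.

  For descending chains and antichains it is enough to reduce the first coordinate modulo \<open>d\<close>: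
  these congruences are ordered by reverse divisibility of the moduli.
\<close>

section \<open>Shift-invariant equivalences\<close>

definition shift_invariant :: "(nat \<times> 'a) rel \<Rightarrow> bool" where
  "shift_invariant r \<longleftrightarrow>
     (\<forall>i \<alpha> j \<beta>. ((i, \<alpha>), (j, \<beta>)) \<in> r \<longrightarrow> ((Suc i, \<alpha>), (Suc j, \<beta>)) \<in> r)"

lemma shift_invariant_add:
  assumes "shift_invariant r" "((i, \<alpha>), (j, \<beta>)) \<in> r"
  shows "((i + k, \<alpha>), (j + k, \<beta>)) \<in> r"
  using assms by (induction k) (auto simp: shift_invariant_def)

text \<open>Shifting \<open>per\<close> links each entry from \<open>m\<close> on to the entry
  \<open>d\<close> further along. Chaining such links joins any two entries from \<open>m\<close> on
  that differ by a multiple of \<open>d\<close>.\<close>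

lemma eventually_periodic_row:
  assumes r: "equiv A r" "shift_invariant r"
    and per: "((m, \<alpha>), (m + d, \<alpha>)) \<in> r"
    and "m \<le> a" "m \<le> b" "a mod d = b mod d"
  shows "((a, \<alpha>), (b, \<alpha>)) \<in> r"
proof -
  have step: "((a, \<alpha>), (a + k * d, \<alpha>)) \<in> r" if "m \<le> a" for a k
  proof (induction k)
    case 0
    \<comment> \<open>Since \<open>A\<close> is arbitrary, the membership needed for reflexivity is
      read off a shift of \<open>per\<close>.\<close>
    have "(m + (a - m), \<alpha>) \<in> A"
      using shift_invariant_add[OF r(2) per] r(1)
      by (meson equiv_type mem_Sigma_iff subsetD)
    then show ?case using r(1) that by (simp add: equiv_def refl_on_def)
  next
    case (Suc k)
    have "((a + k * d, \<alpha>), (a + k * d + d, \<alpha>)) \<in> r"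
      using shift_invariant_add[OF r(2) per, of "a + k * d - m"] that
      by (simp add: algebra_simps)
    with Suc have "((a, \<alpha>), (a + k * d + d, \<alpha>)) \<in> r"
      using r(1) by (meson equivE transD)
    then show ?case by (simp add: algebra_simps)
  qed
  have mono: "((a, \<alpha>), (b, \<alpha>)) \<in> r" if "m \<le> a" "a \<le> b" "a mod d = b mod d" for a b
  proof -
    have "d dvd b - a" using that by (metis mod_eq_dvd_iff_nat)
    then obtain k where "b = a + k * d"
      using \<open>a \<le> b\<close> by (metis dvd_def le_add_diff_inverse mult.commute)
    then show ?thesis using step that(1) by simp
  qed
  show ?thesis
  proof (cases "a \<le> b")
    case True then show ?thesis using mono assms by blast
  next
    case False
    then have "((b, \<alpha>), (a, \<alpha>)) \<in> r" using mono assms by simp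
    then show ?thesis using r(1) by (meson equivE symD)
  qed
qed

text \<open>This puts periodicity into a form suited to the pigeonhole principle: entries below
  \<open>m\<close> keep their own colour, later ones are coloured by their residue modulo the
  period.\<close>

lemma finite_colouring_of_periodic_row:
  assumes r: "equiv (UNIV \<times> P) r" "shift_invariant r"
    and "\<alpha> \<in> P" "m < m'" "((m, \<alpha>), (m', \<alpha>)) \<in> r"
  obtains c :: "nat \<Rightarrow> nat" where "finite (range c)"
    "\<And>a b. c a = c b \<Longrightarrow> ((a, \<alpha>), (b, \<alpha>)) \<in> r"
proof
  define d where "d = m' - m"
  define c where "c a = (if a < m then a else m + a mod d)" for a
  have d: "d > 0" "m' = m + d" using assms(4) by (auto simp: d_def)
  have "range c \<subseteq> {..<m + d}" using d by (auto simp: c_def)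
  then show "finite (range c)" using finite_subset by blast
  fix a b assume "c a = c b"
  then consider "a = b" | "m \<le> a" "m \<le> b" "a mod d = b mod d"
    by (auto simp: c_def split: if_splits)
  then show "((a, \<alpha>), (b, \<alpha>)) \<in> r"
  proof cases
    case 1 then show ?thesis using r(1) \<open>\<alpha> \<in> P\<close> by (simp add: equiv_def refl_on_def)
  next
    case 2 then show ?thesis using eventually_periodic_row[OF r] assms(5) d(2) by blast
  qed
qed

text \<open>Shifting the first pair by \<open>b'\<close> and the second by \<open>b\<close> gives
  both the right end \<open>(b + b', \<beta>)\<close>. Transitivity then relates two distinct
  entries of row \<open>\<alpha>\<close>.\<close>

lemma periodic_row_of_two_differences:
  assumes r: "equiv (UNIV \<times> P) r" "shift_invariant r"
    and "((a, \<alpha>), (b, \<beta>)) \<in> r" "((a', \<alpha>), (b', \<beta>)) \<in> r" "a + b' \<noteq> a' + b"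
  obtains m m' where "m < m'" "((m, \<alpha>), (m', \<alpha>)) \<in> r"
proof -
  have "((a + b', \<alpha>), (b + b', \<beta>)) \<in> r" "((a' + b, \<alpha>), (b + b', \<beta>)) \<in> r"
    using shift_invariant_add[OF r(2) assms(3), of b'] shift_invariant_add[OF r(2) assms(4), of b]
    by (simp_all add: add.commute)
  then have "((a + b', \<alpha>), (a' + b, \<alpha>)) \<in> r" "((a' + b, \<alpha>), (a + b', \<alpha>)) \<in> r"
    using r(1) by (meson equivE symD transD)+
  with that assms(5) show thesis by (metis nat_neq_iff)
qed

lemma no_strictly_ascending_shift_invariant:
  fixes f :: "nat \<Rightarrow> (nat \<times> 'a) rel"
  assumes "finite P"
    and eq: "\<And>i. equiv (UNIV \<times> P) (f i)" and inv: "\<And>i. shift_invariant (f i)"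
    and asc: "\<And>i. f i \<subset> f (Suc i)"
  shows False
proof -
  have mono: "f i \<subseteq> f j" if "i \<le> j" for i j
    using lift_Suc_mono_le[of f] asc that by (meson psubset_imp_subset)
  have "\<forall>k. \<exists>a \<alpha> b \<beta>. ((a, \<alpha>), (b, \<beta>)) \<in> f (Suc k) \<and> ((a, \<alpha>), (b, \<beta>)) \<notin> f k"
    using asc by (metis psubsetE subrelI surj_pair)
  then obtain a \<alpha> b \<beta> where new: "\<And>k. ((a k, \<alpha> k), (b k, \<beta> k)) \<in> f (Suc k)"
      "\<And>k. ((a k, \<alpha> k), (b k, \<beta> k)) \<notin> f k"
    by metis
  have later: "((a k, \<alpha> k), (b k, \<beta> k)) \<in> f l" if "k < l" for k l
    using new(1) mono that by (metis Suc_leI subsetD)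
  have inP: "\<alpha> k \<in> P" "\<beta> k \<in> P" for k
    using new(1)[of k] equiv_type[OF eq] by blast+
  have "finite ((\<lambda>k. (\<alpha> k, \<beta> k)) ` UNIV)"
    by (rule finite_subset[of _ "P \<times> P"]) (use inP \<open>finite P\<close> in auto)
  then obtain k0 where "infinite {k \<in> UNIV. (\<alpha> k, \<beta> k) = (\<alpha> k0, \<beta> k0)}"
    using pigeonhole_infinite[OF infinite_UNIV_nat] by blast
  then obtain I where I: "infinite I" "\<And>k. k \<in> I \<Longrightarrow> \<alpha> k = \<alpha> k0 \<and> \<beta> k = \<beta> k0"
    by (metis (mono_tags, lifting) Pair_inject mem_Collect_eq)
  show False
  proof (cases "\<forall>k\<in>I. \<forall>l\<in>I. a k + b l = a l + b k")
    case True
    \<comment> \<open>Minimality of \<open>a k\<close> makes \<open>a l - a k\<close> a genuine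
      shift, carrying pair \<open>k\<close> to pair \<open>l\<close>.\<close>
    obtain k where k: "k \<in> I" "\<And>l. l \<in> I \<Longrightarrow> a k \<le> a l"
      using I(1) ex_has_least_nat[of "\<lambda>k. k \<in> I" _ a] by (metis finite.emptyI ex_in_conv)
    obtain l where l: "l \<in> I" "k < l"
      using I(1) by (metis infinite_nat_iff_unbounded)
    have "a k + b l = a l + b k" "a k \<le> a l" using True k l(1) by auto
    then have "b k + (a l - a k) = b l" "a k + (a l - a k) = a l" by arith+
    then have "((a l, \<alpha> k), (b l, \<beta> k)) \<in> f l"
      using shift_invariant_add[OF inv later[OF l(2)], of "a l - a k"] by simp
    then show False using new(2)[of l] I(2) k(1) l(1) by metis
  next
    case False
    then obtain k l where kl: "k \<in> I" "l \<in> I" "a k + b l \<noteq> a l + b k" by blast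
    define K where "K = Suc (max k l)"
    have pairs: "((a k, \<alpha> k0), (b k, \<beta> k0)) \<in> f K" "((a l, \<alpha> k0), (b l, \<beta> k0)) \<in> f K"
      using later[of k K] later[of l K] I(2) kl by (auto simp: K_def)
    \<comment> \<open>Swapping the ends lets the same argument make row \<open>\<beta>\<close>
      periodic.\<close>
    then have converse: "((b k, \<beta> k0), (a k, \<alpha> k0)) \<in> f K" "((b l, \<beta> k0), (a l, \<alpha> k0)) \<in> f K"
      using eq by (meson equivE symD)+
    obtain c where c: "finite (range c)"
        "\<And>x y. c x = (c y :: nat) \<Longrightarrow> ((x, \<alpha> k0), (y, \<alpha> k0)) \<in> f K"
      using periodic_row_of_two_differences[OF eq inv pairs kl(3)]
        finite_colouring_of_periodic_row[OF eq inv inP(1)] by metis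
    have "b k + a l \<noteq> b l + a k" using kl(3) by simp
    then obtain c' where c': "finite (range c')"
        "\<And>x y. c' x = (c' y :: nat) \<Longrightarrow> ((x, \<beta> k0), (y, \<beta> k0)) \<in> f K"
      using periodic_row_of_two_differences[OF eq inv converse]
        finite_colouring_of_periodic_row[OF eq inv inP(2)] by metis
    \<comment> \<open>For indices from \<open>K\<close> on, the relations contain \<open>f K\<close>
      and so inherit both colourings.\<close>
    define J where "J = I - {..<K}"
    have "infinite J" using I(1) by (simp add: J_def)
    moreover have "finite ((\<lambda>k. (c (a k), c' (b k))) ` J)"
      by (rule finite_subset[of _ "range c \<times> range c'"]) (use c(1) c'(1) in auto)
    ultimately obtain i where i: "i \<in> J"
        "infinite {k \<in> J. (c (a k), c' (b k)) = (c (a i), c' (b i))}"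
      using pigeonhole_infinite by blast
    then obtain j where j: "j > i" "j \<in> J" "c (a j) = c (a i)" "c' (b i) = c' (b j)"
      unfolding infinite_nat_iff_unbounded by (auto dest!: spec[of _ i])
    \<comment> \<open>Equal colours give the chain from \<open>a j\<close> to \<open>a i\<close> to
      \<open>b i\<close> to \<open>b j\<close> inside \<open>f j\<close>, which contradicts the
      newness of pair \<open>j\<close>.\<close>
    have "f K \<subseteq> f j" using j(2) mono by (auto simp: J_def)
    then have "((a j, \<alpha> k0), (a i, \<alpha> k0)) \<in> f j" "((b i, \<beta> k0), (b j, \<beta> k0)) \<in> f j"
      using c(2)[OF j(3)] c'(2)[OF j(4)] by blast+
    moreover have "((a i, \<alpha> k0), (b i, \<beta> k0)) \<in> f j"
      using later[OF j(1)] I(2)[of i] i(1) by (simp add: J_def)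
    ultimately have "((a j, \<alpha> k0), (b j, \<beta> k0)) \<in> f j"
      using eq[of j] by (meson equivE transD)
    then show False using new(2)[of j] I(2)[of j] j(2) by (simp add: J_def)
  qed
qed

section \<open>The twisted partition monoid\<close>

lemma finite_partitions: "finite (partitions n)"
proof (rule finite_subset)
  show "partitions n \<subseteq> Pow (Pow (uppers n \<union> lowers n))"
    by (auto simp: partitions_def partition_on_def)
qed (simp add: uppers_def lowers_def)

lemma partition_one_in_partitions: "partition_one n \<in> partitions n"
proof -
  have "\<Union>(partition_one n) = uppers n \<union> lowers n"
    unfolding partition_one_def uppers_def lowers_def by blast
  then show ?thesis
    by (auto simp: partitions_def partition_on_def disjoint_def partition_one_def)
qed

section \<open>Products with the identity partition on the left\<close>

lemma sym_product_edges: "sym (product_edges \<alpha> \<beta>)"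
  by (auto simp: sym_def product_edges_def)

lemma equiv_connected_on: "equiv V (connected_on V \<alpha> \<beta>)"
proof (rule equivI)
  show "sym (connected_on V \<alpha> \<beta>)"
    using sym_rtrancl[OF sym_product_edges] by (auto simp: sym_def connected_on_def)
qed (auto simp: connected_on_def refl_on_def trans_def)

lemma partition_mult_in_partitions: "partition_mult n \<alpha> \<beta> \<in> partitions n"
  by (simp add: partitions_def partition_mult_def Let_def partition_on_quotient equiv_connected_on)

lemma one_product_edge:
  assumes "x \<in> {1..n}"
  shows "(Up x, Mid x) \<in> product_edges (partition_one n) \<beta>"
proof -
  have "{Up x, Low x} \<in> partition_one n" using assms by (auto simp: partition_one_def)
  moreover have "lower_to_middle ` {Up x, Low x} = {Up x, Mid x}" by simp
  ultimately show ?thesis unfolding product_edges_def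
    by (metis (mono_tags, lifting) case_prodI insertI1 insertI2 mem_Collect_eq)
qed

text \<open>Contracts each edge from \<open>Up x\<close> to \<open>Mid x\<close>, the map under
  which the product graph of the identity and \<open>\<beta>\<close> collapses onto the blocks of
  \<open>\<beta>\<close>.\<close>

fun middle_to_upper :: "vertex \<Rightarrow> vertex" where
  "middle_to_upper (Mid x) = Up x"
| "middle_to_upper v = v"

lemma one_product_edgeD:
  assumes \<beta>: "\<beta> \<in> partitions n" and "(u, v) \<in> product_edges (partition_one n) \<beta>"
  shows "middle_to_upper u = middle_to_upper v \<or>
    (\<exists>B\<in>\<beta>. middle_to_upper u \<in> B \<and> middle_to_upper v \<in> B)"
proof -
  \<comment> \<open>Blocks of \<open>\<beta>\<close> contain no middle vertices, so the contraction
    undoes the renaming.\<close>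
  have [simp]: "middle_to_upper (upper_to_middle w) = w" if "B \<in> \<beta>" "w \<in> B" for B w
    using \<beta> that by (cases w) (auto simp: partitions_def partition_on_def uppers_def lowers_def)
  show ?thesis
    using assms(2) by (fastforce simp: product_edges_def partition_one_def)
qed

text \<open>A contracted path stays in one block, as blocks are disjoint. Conversely, two vertices
  of a block are joined by moving to the renamed vertices, using one edge of \<open>\<beta>\<close>,
  and moving back.\<close>

lemma connected_on_one:
  assumes \<beta>: "\<beta> \<in> partitions n"
  shows "connected_on (uppers n \<union> lowers n) (partition_one n) \<beta>
    = {(u, v). \<exists>B\<in>\<beta>. u \<in> B \<and> v \<in> B}" (is "?C = ?R")
proof -
  let ?E = "product_edges (partition_one n) \<beta>"
  have part: "partition_on (uppers n \<union> lowers n) \<beta>" using \<beta> by (simp add: partitions_def)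
  have R_trans: "\<exists>B\<in>\<beta>. x \<in> B \<and> z \<in> B"
    if "B \<in> \<beta>" "x \<in> B" "y \<in> B" "B' \<in> \<beta>" "y \<in> B'" "z \<in> B'" for x y z B B'
    using that disjointD[OF partition_onD2[OF part], of B B'] by blast
  have path: "middle_to_upper u = middle_to_upper v \<or>
      (middle_to_upper u, middle_to_upper v) \<in> ?R" if "(u, v) \<in> ?E\<^sup>*" for u v
    using that
  proof (induction rule: rtrancl_induct)
    case (step v w)
    then show ?case using one_product_edgeD[OF \<beta> step(2)] R_trans by auto
  qed simp
  have to_middle: "(u, upper_to_middle u) \<in> ?E\<^sup>*" if "u \<in> uppers n \<union> lowers n" for u
    using that by (auto simp: uppers_def lowers_def intro!: one_product_edge[THEN r_into_rtrancl])
  show ?thesis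
  proof (intro equalityI subrelI)
    fix u v assume "(u, v) \<in> ?C"
    then have uv: "u \<in> uppers n \<union> lowers n" "v \<in> uppers n \<union> lowers n" "(u, v) \<in> ?E\<^sup>*"
      by (auto simp: connected_on_def)
    then have "middle_to_upper u = u" "middle_to_upper v = v"
      by (auto simp: uppers_def lowers_def)
    with path[OF uv(3)] have "u = v \<or> (u, v) \<in> ?R" by simp
    then show "(u, v) \<in> ?R" using uv(1) partition_onD1[OF part] by auto
  next
    fix u v assume "(u, v) \<in> ?R"
    then obtain B where B: "B \<in> \<beta>" "u \<in> B" "v \<in> B" by blast
    then have uv: "u \<in> uppers n \<union> lowers n" "v \<in> uppers n \<union> lowers n"
      using partition_onD1[OF part] by auto
    have "(upper_to_middle u, upper_to_middle v) \<in> ?E" using B by (auto simp: product_edges_def)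
    moreover have "(upper_to_middle v, v) \<in> ?E\<^sup>*"
      using to_middle[OF uv(2)] sym_rtrancl[OF sym_product_edges] by (meson symD)
    ultimately have "(u, v) \<in> ?E\<^sup>*" using to_middle[OF uv(1)]
      by (meson rtrancl.rtrancl_into_rtrancl rtrancl_trans)
    then show "(u, v) \<in> ?C" using uv by (simp add: connected_on_def)
  qed
qed

lemma partition_mult_one:
  assumes "\<beta> \<in> partitions n"
  shows "partition_mult n (partition_one n) \<beta> = \<beta>"
  using assms
  by (simp add: partition_mult_def Let_def connected_on_one partitions_def partition_on_eq_quotient)

text \<open>Every \<open>Mid x\<close> is adjacent to \<open>Up x\<close>, so no component stays in
  the middle row.\<close>

lemma floating_one: "floating n (partition_one n) \<beta> = 0"
proof -
  define V where "V = uppers n \<union> middles n \<union> lowers n"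
  let ?R = "connected_on V (partition_one n) \<beta>"
  have "\<not> C \<subseteq> middles n" if "C \<in> V // ?R" for C
  proof
    assume sub: "C \<subseteq> middles n"
    obtain v where v: "v \<in> V" "C = ?R `` {v}" using \<open>C \<in> V // ?R\<close> by (rule quotientE)
    then have "v \<in> C" using equiv_class_self[OF equiv_connected_on] by blast
    then obtain x where x: "x \<in> {1..n}" "v = Mid x" using sub by (auto simp: middles_def)
    then have "(Mid x, Up x) \<in> product_edges (partition_one n) \<beta>"
      using one_product_edge sym_product_edges by (meson symD)
    then have "Up x \<in> C"
      using v x by (auto simp: connected_on_def V_def uppers_def)
    then show False using sub by (auto simp: middles_def)
  qed
  then have none: "{C \<in> V // ?R. C \<subseteq> middles n} = {}" by blast
  show ?thesis
    by (simp add: none floating_def product_components_def V_def[symmetric])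
qed

lemma Cong_shift_invariant:
  assumes "r \<in> Cong (twisted_partition_monoid n)"
  shows "equiv (UNIV \<times> partitions n) r" "shift_invariant r"
proof -
  let ?M = "twisted_partition_monoid n"
  show eq: "equiv (UNIV \<times> partitions n) r"
    using assms by (simp add: Cong_def twisted_partition_monoid_def)
  have gen: "((1, partition_one n), (1, partition_one n)) \<in> r"
    using eq partition_one_in_partitions by (simp add: equiv_def refl_on_def)
  show "shift_invariant r"
    unfolding shift_invariant_def
  proof (intro allI impI)
    fix i \<alpha> j \<beta> assume pair: "((i, \<alpha>), (j, \<beta>)) \<in> r"
    then have "\<alpha> \<in> partitions n" "\<beta> \<in> partitions n" using equiv_type[OF eq] by auto
    moreover have "((1, partition_one n) \<otimes>\<^bsub>?M\<^esub> (i, \<alpha>), (1, partition_one n) \<otimes>\<^bsub>?M\<^esub> (j, \<beta>)) \<in> r"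
      using assms gen pair by (fastforce simp: Cong_def)
    ultimately show "((Suc i, \<alpha>), (Suc j, \<beta>)) \<in> r"
      by (simp add: twisted_partition_monoid_def partition_mult_one floating_one)
  qed
qed

section \<open>Congruences given by residues of the first coordinate\<close>

definition mod_congruence :: "nat \<Rightarrow> nat \<Rightarrow> (nat \<times> vertex set set) rel" where
  "mod_congruence n d = {((i, \<alpha>), (j, \<beta>)). \<alpha> \<in> partitions n \<and> \<alpha> = \<beta> \<and> i mod d = j mod d}"

text \<open>Related elements share their partition, so both products gain the same
  \<open>floating\<close> term and only residues have to be added.\<close>

lemma mod_congruence_in_Cong: "mod_congruence n d \<in> Cong (twisted_partition_monoid n)"
proof -
  let ?M = "twisted_partition_monoid n"
  have "equiv (UNIV \<times> partitions n) (mod_congruence n d)"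
    by (rule equivI) (auto simp: mod_congruence_def refl_on_def sym_def trans_def)
  moreover have "(x \<otimes>\<^bsub>?M\<^esub> z, y \<otimes>\<^bsub>?M\<^esub> w) \<in> mod_congruence n d"
    if "(x, y) \<in> mod_congruence n d" "(z, w) \<in> mod_congruence n d" for x y z w
  proof -
    obtain i j \<alpha> where xy: "x = (i, \<alpha>)" "y = (j, \<alpha>)" "i mod d = j mod d"
      using \<open>(x, y) \<in> _\<close> by (auto simp: mod_congruence_def)
    obtain k l \<beta> where zw: "z = (k, \<beta>)" "w = (l, \<beta>)" "k mod d = l mod d"
      using \<open>(z, w) \<in> _\<close> by (auto simp: mod_congruence_def)
    have "(i + k + floating n \<alpha> \<beta>) mod d = (j + l + floating n \<alpha> \<beta>) mod d"
      using xy(3) zw(3) by (intro mod_add_cong refl)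
    then show ?thesis
      by (simp add: xy(1,2) zw(1,2) twisted_partition_monoid_def mod_congruence_def
          partition_mult_in_partitions)
  qed
  moreover have "carrier ?M = UNIV \<times> partitions n" by (simp add: twisted_partition_monoid_def)
  ultimately show ?thesis unfolding Cong_def by auto
qed

lemma mod_congruence_subset_iff: "mod_congruence n d \<subseteq> mod_congruence n e \<longleftrightarrow> e dvd d"
proof
  assume "mod_congruence n d \<subseteq> mod_congruence n e"
  \<comment> \<open>This pair is the test: it lies in the congruence modulo \<open>e\<close> only if
    \<open>e\<close> divides \<open>d\<close>.\<close>
  moreover have "((d, partition_one n), (0, partition_one n)) \<in> mod_congruence n d"
    by (simp add: mod_congruence_def partition_one_in_partitions)
  ultimately have "((d, partition_one n), (0, partition_one n)) \<in> mod_congruence n e" by blast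
  then show "e dvd d" by (simp add: mod_congruence_def mod_eq_0_iff_dvd)
next
  assume "e dvd d"
  then show "mod_congruence n d \<subseteq> mod_congruence n e"
    by (auto simp: mod_congruence_def) (metis mod_mod_cancel)
qed

theorem theorem4p3:
  fixes n :: nat
  assumes "n \<ge> 1"
  shows "(\<nexists>f :: nat \<Rightarrow> (nat \<times> vertex set set) rel.
            (\<forall>i. f i \<in> Cong (twisted_partition_monoid n)) \<and> (\<forall>i. f i \<subset> f (Suc i)))
       \<and> (\<exists>f :: nat \<Rightarrow> (nat \<times> vertex set set) rel.
            (\<forall>i. f i \<in> Cong (twisted_partition_monoid n)) \<and> (\<forall>i. f (Suc i) \<subset> f i))
       \<and> (\<exists>A. A \<subseteq> Cong (twisted_partition_monoid n) \<and> infinite A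
            \<and> pairwise (\<lambda>r s. \<not> r \<subseteq> s) A)"
proof (intro conjI)
  show "\<nexists>f :: nat \<Rightarrow> (nat \<times> vertex set set) rel.
      (\<forall>i. f i \<in> Cong (twisted_partition_monoid n)) \<and> (\<forall>i. f i \<subset> f (Suc i))"
  proof (intro notI, elim exE conjE)
    fix f assume f: "\<forall>i. f i \<in> Cong (twisted_partition_monoid n)" "\<forall>i. f i \<subset> f (Suc i)"
    show False
      by (rule no_strictly_ascending_shift_invariant[OF finite_partitions, of n f])
        (use f Cong_shift_invariant in blast)+
  qed
  \<comment> \<open>Each power of 2 divides the next but not conversely, so the inclusions are
    strict.\<close>
  have "mod_congruence n (2 ^ Suc i) \<subset> mod_congruence n (2 ^ i)" for i
    unfolding less_le_not_le mod_congruence_subset_iff by simp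
  then show "\<exists>f :: nat \<Rightarrow> (nat \<times> vertex set set) rel.
      (\<forall>i. f i \<in> Cong (twisted_partition_monoid n)) \<and> (\<forall>i. f (Suc i) \<subset> f i)"
    using mod_congruence_in_Cong by (intro exI[of _ "\<lambda>i. mod_congruence n (2 ^ i)"]) simp
  show "\<exists>A. A \<subseteq> Cong (twisted_partition_monoid n) \<and> infinite A
      \<and> pairwise (\<lambda>r s. \<not> r \<subseteq> s) A"
  proof (intro exI conjI)
    \<comment> \<open>Distinct primes do not divide each other, so their congruences are
      incomparable.\<close>
    let ?A = "mod_congruence n ` {p. prime p}"
    show "?A \<subseteq> Cong (twisted_partition_monoid n)" using mod_congruence_in_Cong by blast
    have "inj (mod_congruence n)"
      by (metis injI dvd_antisym mod_congruence_subset_iff order_refl)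
    then show "infinite ?A"
      using primes_infinite by (metis finite_imageD inj_on_subset subset_UNIV)
    show "pairwise (\<lambda>r s. \<not> r \<subseteq> s) ?A"
      by (auto simp: pairwise_def mod_congruence_subset_iff dest: primes_dvd_imp_eq)
  qed
qed

end
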